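(* Let $G$ be a split graph. Then $\gamma_f^\infty(G)=F(G)$.
   Context: All graphs are finite, simple and undirected. A split graph is a graph whose vertex set can be partitioned into a clique and an independent set. $N(v)$ is the open neighbourhood and $N[v]=N(v)\cup\{v\}$ the closed neighbourhood of $v$. A fractional dominating function of $G=(V,E)$ is a function $w:V\to[0,\infty)$ with $\sum_{x\in N[v]}w(x)\ge 1$ for all $v\in V$; its total weight is $\sum_{x\in V}w(x)$. For $v\in V(G)$, $f(v)$ is the least total weight of a fractional dominating function of $G$ in which the weight assigned to $v$ is at least $1$, and $F(G)=\max\{f(v):v\in V(G)\}$. Fractional eternal domination. Fix $S$. The defender chooses a fractional dominating function $w_1$ of total weight at most $S$. In each round $i\ge 1$ the attacker, who may choose attacks adaptively, attacks a vertex $v_i\in V$, and the defender chooses amounts $m_{xy,i}\ge 0$ for all $x\in V$, $y\in N(x)$, with $\sum_{y\in N(x)}m_{xy,i}\le w_i(x)$, and sets $w_{i+1}(x)=w_i(x)-\sum_{y\in N(x)}m_{xy,i}+\sum_{y\in N(x)}m_{yx,i}$. It is required that $w_{i+1}$ be a fractional dominating function and $w_{i+1}(v_i)\ge 1$. If the defender can respond in this way to every infinite sequence of attacks, $G$ can be eternally $S$-fractionally dominated. $\gamma_f^\infty(G)$ is the infimum of all $S$ for which $G$ can be eternally $S$-fractionally dominated. *)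

theory Defs
  imports "HOL-Analysis.Analysis" "Graph_Theory.Pair_Digraph"
begin

text \<open>
  Finite simple undirected graphs are the instances of \<^locale>\<open>pair_graph\<close>: an undirected edge
  is represented by its two opposite arcs. Vertex weights are total functions on the ambient
  type; only their values on \<open>pverts G\<close> matter.
\<close>

definition nbhd :: "'a pair_pre_digraph \<Rightarrow> 'a \<Rightarrow> 'a set" where
  "nbhd G v = {u \<in> pverts G. (v, u) \<in> parcs G}"

definition closed_nbhd :: "'a pair_pre_digraph \<Rightarrow> 'a \<Rightarrow> 'a set" where
  "closed_nbhd G v = insert v (nbhd G v)"

definition clique :: "'a pair_pre_digraph \<Rightarrow> 'a set \<Rightarrow> bool" where
  "clique G K \<longleftrightarrow> K \<subseteq> pverts G \<and> (\<forall>u\<in>K. \<forall>v\<in>K. u \<noteq> v \<longrightarrow> (u, v) \<in> parcs G)"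

definition independent_set :: "'a pair_pre_digraph \<Rightarrow> 'a set \<Rightarrow> bool" where
  "independent_set G I \<longleftrightarrow> I \<subseteq> pverts G \<and> (\<forall>u\<in>I. \<forall>v\<in>I. (u, v) \<notin> parcs G)"

text \<open>As usual, either part of the partition may be empty.\<close>

definition split_graph :: "'a pair_pre_digraph \<Rightarrow> bool" where
  "split_graph G \<longleftrightarrow> pair_graph G \<and>
     (\<exists>K I. K \<union> I = pverts G \<and> K \<inter> I = {} \<and> clique G K \<and> independent_set G I)"

definition frac_dominating :: "'a pair_pre_digraph \<Rightarrow> ('a \<Rightarrow> real) \<Rightarrow> bool" where
  "frac_dominating G w \<longleftrightarrow>
     (\<forall>x\<in>pverts G. 0 \<le> w x) \<and> (\<forall>v\<in>pverts G. (\<Sum>x\<in>closed_nbhd G v. w x) \<ge> 1)"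

definition total_weight :: "'a pair_pre_digraph \<Rightarrow> ('a \<Rightarrow> real) \<Rightarrow> real" where
  "total_weight G w = (\<Sum>x\<in>pverts G. w x)"

definition least_weight_at :: "'a pair_pre_digraph \<Rightarrow> 'a \<Rightarrow> real" where
  "least_weight_at G v =
     (LEAST t. \<exists>w. frac_dominating G w \<and> w v \<ge> 1 \<and> total_weight G w = t)"

text \<open>The minimum in this definition is attained, so that \<open>LEAST\<close> denotes it.\<close>

lemma least_weight_at_attained:
  assumes "pair_graph G" and v: "v \<in> pverts G"
  shows "\<exists>w. frac_dominating G w \<and> w v \<ge> 1 \<and> total_weight G w = least_weight_at G v"
    and "\<And>w. frac_dominating G w \<Longrightarrow> w v \<ge> 1 \<Longrightarrow> least_weight_at G v \<le> total_weight G w"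
proof -
  interpret pair_graph G by fact
  define V where "V = pverts G"
  have fin: "finite V" unfolding V_def by (rule pair_finite_verts)
  define N where "N = real (card V)"
  define B :: "('a \<Rightarrow> real) set" where
    "B = PiE UNIV (\<lambda>x. if x \<in> V then {0..N} else {0})"
  define C where "C = (\<Inter>u\<in>V. {w. (\<Sum>x\<in>closed_nbhd G u. w x) \<ge> 1}) \<inter> {w. w v \<ge> (1::real)}"
  have cont: "continuous_on UNIV (\<lambda>w::'a \<Rightarrow> real. \<Sum>x\<in>A. w x)" for A
    by (intro continuous_on_sum continuous_on_product_coordinates)
  have "compact B"
    using compactin_PiE[of "\<lambda>_::'a. euclidean :: real topology" UNIV
        "\<lambda>x. if x \<in> V then {0..N} else {0}"]
    unfolding B_def by (simp add: euclidean_product_topology)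
  moreover have "closed C"
    unfolding C_def
    by (intro closed_Int closed_INT ballI closed_Collect_le cont
        continuous_on_const continuous_on_product_coordinates)
  ultimately have comp: "compact (B \<inter> C)"
    by (rule compact_Int_closed)
  have restr: "\<exists>u\<in>B \<inter> C. total_weight G u = total_weight G w"
    if w: "frac_dominating G w" "w v \<ge> 1" "total_weight G w \<le> N" for w
  proof
    define u where "u = (\<lambda>x. if x \<in> V then w x else 0)"
    have nn: "w x \<ge> 0" if "x \<in> V" for x
      using w(1) that by (simp add: frac_dominating_def V_def)
    have "w x \<le> N" if "x \<in> V" for x
      using w(3) member_le_sum[OF that, of w] nn fin
      by (auto simp: total_weight_def V_def[symmetric])
    then have "u \<in> B" using nn by (auto simp: B_def u_def)
    moreover have "(\<Sum>x\<in>closed_nbhd G y. u x) = (\<Sum>x\<in>closed_nbhd G y. w x)" if "y \<in> V" for y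
      by (rule sum.cong) (use that in \<open>auto simp: u_def V_def closed_nbhd_def nbhd_def\<close>)
    then have "u \<in> C"
      using w(1,2) v by (auto simp: C_def frac_dominating_def V_def u_def)
    ultimately show "u \<in> B \<inter> C" by blast
    show "total_weight G u = total_weight G w"
      by (simp add: total_weight_def u_def V_def)
  qed
  have feas: "frac_dominating G u \<and> u v \<ge> 1" if "u \<in> B \<inter> C" for u
  proof -
    have "u x \<ge> 0" if "x \<in> V" for x
      using \<open>u \<in> B \<inter> C\<close> that by (auto simp: B_def PiE_iff dest!: spec[of _ x])
    then show ?thesis using that by (auto simp: C_def frac_dominating_def V_def)
  qed
  have one: "frac_dominating G (\<lambda>_. 1)"
    unfolding frac_dominating_def
  proof safe
    fix y assume "y \<in> pverts G"
    have "finite (nbhd G y)" using fin by (simp add: nbhd_def V_def)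
    then show "1 \<le> (\<Sum>x\<in>closed_nbhd G y. 1::real)"
      by (simp add: closed_nbhd_def card_insert_if card_gt_0_iff Suc_le_eq)
        (metis card_gt_0_iff empty_iff One_nat_def Suc_leI)
  qed simp
  have oneN: "total_weight G (\<lambda>_. 1) = N" by (simp add: total_weight_def N_def V_def)
  have "B \<inter> C \<noteq> {}" using restr[OF one] oneN by auto
  then obtain u where u: "u \<in> B \<inter> C" and
    umin: "\<And>w. w \<in> B \<inter> C \<Longrightarrow> total_weight G u \<le> total_weight G w"
    using continuous_attains_inf[OF comp, of "total_weight G"]
      continuous_on_subset[OF cont subset_UNIV]
    unfolding total_weight_def by blast
  have min: "total_weight G u \<le> total_weight G w" if "frac_dominating G w" "w v \<ge> 1" for w
  proof (cases "total_weight G w \<le> N")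
    case True
    then show ?thesis using restr[OF that] umin by metis
  next
    case False
    have "total_weight G u \<le> N" using restr[OF one] oneN umin by (metis order_refl)
    then show ?thesis using False by simp
  qed
  have eq: "least_weight_at G v = total_weight G u"
    unfolding least_weight_at_def
    by (rule Least_equality) (use feas[OF u] min in auto)
  show "\<exists>w. frac_dominating G w \<and> w v \<ge> 1 \<and> total_weight G w = least_weight_at G v"
    using feas[OF u] eq by auto
  show "least_weight_at G v \<le> total_weight G w" if "frac_dominating G w" "w v \<ge> 1" for w
    using min[OF that] eq by simp
qed

definition max_least_weight :: "'a pair_pre_digraph \<Rightarrow> real" where
  "max_least_weight G = Max (least_weight_at G ` pverts G)"

text \<open>\<open>m x y\<close> is the amount moved from \<open>x\<close> to its neighbour \<open>y\<close>.\<close>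

definition legal_move :: "'a pair_pre_digraph \<Rightarrow> ('a \<Rightarrow> real) \<Rightarrow> ('a \<Rightarrow> 'a \<Rightarrow> real) \<Rightarrow> bool" where
  "legal_move G w m \<longleftrightarrow>
     (\<forall>x\<in>pverts G. (\<forall>y\<in>nbhd G x. m x y \<ge> 0) \<and> (\<Sum>y\<in>nbhd G x. m x y) \<le> w x)"

definition apply_move ::
  "'a pair_pre_digraph \<Rightarrow> ('a \<Rightarrow> real) \<Rightarrow> ('a \<Rightarrow> 'a \<Rightarrow> real) \<Rightarrow> 'a \<Rightarrow> real" where
  "apply_move G w m x = w x - (\<Sum>y\<in>nbhd G x. m x y) + (\<Sum>y\<in>nbhd G x. m y x)"

text \<open>
  A defender strategy maps the list of attacks made so far (oldest first, the current attack
  last) to the amounts moved in response, so that it cannot depend on future attacks. Rounds are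
  numbered from 0: \<open>a i\<close> is the attack of round \<open>i\<close>, and \<open>weight_at G w1 \<sigma> a i\<close> is the weight
  function before that attack.
\<close>

type_synonym 'a strategy = "'a list \<Rightarrow> 'a \<Rightarrow> 'a \<Rightarrow> real"

primrec weight_at ::
  "'a pair_pre_digraph \<Rightarrow> ('a \<Rightarrow> real) \<Rightarrow> 'a strategy \<Rightarrow> (nat \<Rightarrow> 'a) \<Rightarrow> nat \<Rightarrow> 'a \<Rightarrow> real" where
  "weight_at G w1 \<sigma> a 0 = w1"
| "weight_at G w1 \<sigma> a (Suc i) = apply_move G (weight_at G w1 \<sigma> a i) (\<sigma> (map a [0..<Suc i]))"

text \<open>
  Quantifying over all attack sequences after the strategy has been fixed covers adaptive
  attackers: an adaptive attacker playing against a fixed strategy produces such a sequence.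
\<close>

definition eternally_dominable :: "'a pair_pre_digraph \<Rightarrow> real \<Rightarrow> bool" where
  "eternally_dominable G S \<longleftrightarrow>
     (\<exists>w1 \<sigma>. frac_dominating G w1 \<and> total_weight G w1 \<le> S \<and>
       (\<forall>a. (\<forall>i. a i \<in> pverts G) \<longrightarrow>
         (\<forall>i. legal_move G (weight_at G w1 \<sigma> a i) (\<sigma> (map a [0..<Suc i])) \<and>
              frac_dominating G (weight_at G w1 \<sigma> a (Suc i)) \<and>
              weight_at G w1 \<sigma> a (Suc i) (a i) \<ge> 1)))"

definition frac_eternal_domination_number :: "'a pair_pre_digraph \<Rightarrow> real" where
  "frac_eternal_domination_number G = Inf {S. eternally_dominable G S}"

end

theory Submission
  imports Defs
begin

text \<open>
  A move preserves the total weight, and the attack on \<open>v\<close> leaves the defender with a fractional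
  dominating function of weight at least 1 at \<open>v\<close>. So every sufficient budget is at least the
  least weight at \<open>v\<close>, for each \<open>v\<close>. This half holds for all graphs.

  For the other half let \<open>K\<close> be the clique and \<open>I\<close> the independent set. A vertex of \<open>I\<close> that is not
  isolated has a neighbour \<open>y\<close> in \<open>K\<close>, and every closed neighbourhood that contains the vertex
  contains \<open>y\<close> as well. Weight on \<open>I\<close> can therefore be pushed into \<open>K\<close> without harm, so that for
  each \<open>v\<close> there is a \<^emph>\<open>guard\<close> \<open>c v\<close>: a fractional dominating function of total weight \<open>F(G)\<close> with
  weight at least 1 at \<open>v\<close> whose restriction to \<open>I\<close> is the indicator function of \<open>v\<close> and the isolated
  vertices (\<open>guard_exists\<close>). The defender answers an attack on \<open>v\<close> by going to \<open>c v\<close>.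

  It remains to go from \<open>c u\<close> to \<open>c v\<close> in one round (\<open>transportable_split\<close>). On \<open>I\<close> the two differ at
  most in that one unit disappears from \<open>u\<close> and one unit appears at \<open>v\<close>. As \<open>c v\<close> dominates \<open>u\<close>, it
  has weight at least 1 on the neighbours of \<open>u\<close>, and they can take up the unit that leaves \<open>u\<close>; as
  \<open>c u\<close> dominates \<open>v\<close>, the neighbours of \<open>v\<close> can supply the unit that \<open>v\<close> needs. All remaining
  weight lies in \<open>K\<close>, where it can be rearranged at will.
\<close>

section \<open>Transport plans and moves\<close>

text \<open>
  A round described by its plan: \<open>t x y\<close> is the weight that starts at \<open>x\<close> and ends at \<open>y\<close>. The
  diagonal holds the weight that stays. In contrast to moves, plans can be added and reversed.
\<close>

definition transportable ::
  "'a pair_pre_digraph \<Rightarrow> ('a \<Rightarrow> real) \<Rightarrow> ('a \<Rightarrow> real) \<Rightarrow> bool" where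
  "transportable G w w' \<longleftrightarrow>
     (\<exists>t. (\<forall>x\<in>pverts G. \<forall>y\<in>pverts G. 0 \<le> t x y \<and> (t x y \<noteq> 0 \<longrightarrow> y \<in> closed_nbhd G x)) \<and>
          (\<forall>x\<in>pverts G. (\<Sum>y\<in>pverts G. t x y) = w x) \<and>
          (\<forall>y\<in>pverts G. (\<Sum>x\<in>pverts G. t x y) = w' y))"

context pair_graph
begin

lemma nbhd_sym: "x \<in> nbhd G y \<Longrightarrow> y \<in> nbhd G x"
  using arcs_symmetric[of y x] arc_fst_in_verts[of "(y, x)"] by (auto simp: nbhd_def)

lemma closed_nbhd_sym:
  "x \<in> closed_nbhd G y \<Longrightarrow> y \<in> closed_nbhd G x"
  using nbhd_sym by (auto simp: closed_nbhd_def)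

lemma not_in_nbhd_self: "x \<notin> nbhd G x"
  using pair_no_loops[of "(x, x)"] by (auto simp: nbhd_def)

lemma nbhd_subset: "nbhd G x \<subseteq> pverts G"
  by (auto simp: nbhd_def)

lemma finite_nbhd: "finite (nbhd G x)"
  by (rule finite_subset[OF nbhd_subset]) simp

lemma sum_closed_nbhd: "(\<Sum>y\<in>closed_nbhd G x. w y) = w x + (\<Sum>y\<in>nbhd G x. w y)"
  for w :: "'a \<Rightarrow> real"
  by (simp add: closed_nbhd_def not_in_nbhd_self finite_nbhd)

lemma sum_split_off_self:
  fixes f :: "'a \<Rightarrow> real"
  assumes "x \<in> pverts G" and "\<And>y. y \<in> pverts G \<Longrightarrow> f y \<noteq> 0 \<Longrightarrow> y \<in> closed_nbhd G x"
  shows "(\<Sum>y\<in>pverts G. f y) = f x + (\<Sum>y\<in>nbhd G x. f y)"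
proof -
  have "(\<Sum>y\<in>pverts G. f y) = (\<Sum>y\<in>closed_nbhd G x. f y)"
    by (rule sum.mono_neutral_right)
      (use assms nbhd_subset in \<open>auto simp: closed_nbhd_def\<close>)
  then show ?thesis by (simp add: sum_closed_nbhd)
qed

lemma transportable_imp_move:
  assumes "transportable G w w'"
  obtains m where "legal_move G w m" and "\<And>x. x \<in> pverts G \<Longrightarrow> apply_move G w m x = w' x"
proof -
  obtain t where
    nonneg: "\<And>x y. x \<in> pverts G \<Longrightarrow> y \<in> pverts G \<Longrightarrow> 0 \<le> t x y" and
    local: "\<And>x y. x \<in> pverts G \<Longrightarrow> y \<in> pverts G \<Longrightarrow> t x y \<noteq> 0 \<Longrightarrow> y \<in> closed_nbhd G x" and
    out: "\<And>x. x \<in> pverts G \<Longrightarrow> (\<Sum>y\<in>pverts G. t x y) = w x" and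
    into: "\<And>y. y \<in> pverts G \<Longrightarrow> (\<Sum>x\<in>pverts G. t x y) = w' y"
    using assms unfolding transportable_def by blast
  have row: "(\<Sum>y\<in>nbhd G x. t x y) = w x - t x x" if "x \<in> pverts G" for x
    using sum_split_off_self[OF that, of "t x"] local out that by force
  have column: "(\<Sum>y\<in>nbhd G x. t y x) = w' x - t x x" if "x \<in> pverts G" for x
    using sum_split_off_self[OF that, of "\<lambda>y. t y x"] local closed_nbhd_sym into that by force
  show thesis
  proof
    show "legal_move G w t"
      using nonneg nbhd_subset row by (auto simp: legal_move_def)
    show "apply_move G w t x = w' x" if "x \<in> pverts G" for x
      using row[OF that] column[OF that] by (simp add: apply_move_def)
  qed
qed

lemma transportable_cong:
  assumes "transportable G w1 w2"
    and "\<And>x. x \<in> pverts G \<Longrightarrow> w1 x = w1' x" and "\<And>x. x \<in> pverts G \<Longrightarrow> w2 x = w2' x"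
  shows "transportable G w1' w2'"
  using assms unfolding transportable_def by auto

lemma transportable_converse:
  assumes "transportable G w w'"
  shows "transportable G w' w"
proof -
  obtain t where t:
    "\<forall>x\<in>pverts G. \<forall>y\<in>pverts G. 0 \<le> t x y \<and> (t x y \<noteq> 0 \<longrightarrow> y \<in> closed_nbhd G x)"
    "\<forall>x\<in>pverts G. (\<Sum>y\<in>pverts G. t x y) = w x"
    "\<forall>y\<in>pverts G. (\<Sum>x\<in>pverts G. t x y) = w' y"
    using assms unfolding transportable_def by blast
  show ?thesis
    unfolding transportable_def
    by (rule exI[of _ "\<lambda>x y. t y x"]) (use t closed_nbhd_sym in auto)
qed

lemma transportable_add:
  assumes "transportable G w1 w1'" and "transportable G w2 w2'"
  shows "transportable G (\<lambda>x. w1 x + w2 x) (\<lambda>x. w1' x + w2' x)"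
proof -
  obtain t1 where t1:
    "\<forall>x\<in>pverts G. \<forall>y\<in>pverts G. 0 \<le> t1 x y \<and> (t1 x y \<noteq> 0 \<longrightarrow> y \<in> closed_nbhd G x)"
    "\<forall>x\<in>pverts G. (\<Sum>y\<in>pverts G. t1 x y) = w1 x"
    "\<forall>y\<in>pverts G. (\<Sum>x\<in>pverts G. t1 x y) = w1' y"
    using assms(1) unfolding transportable_def by blast
  obtain t2 where t2:
    "\<forall>x\<in>pverts G. \<forall>y\<in>pverts G. 0 \<le> t2 x y \<and> (t2 x y \<noteq> 0 \<longrightarrow> y \<in> closed_nbhd G x)"
    "\<forall>x\<in>pverts G. (\<Sum>y\<in>pverts G. t2 x y) = w2 x"
    "\<forall>y\<in>pverts G. (\<Sum>x\<in>pverts G. t2 x y) = w2' y"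
    using assms(2) unfolding transportable_def by blast
  have "y \<in> closed_nbhd G x"
    if "x \<in> pverts G" "y \<in> pverts G" "t1 x y + t2 x y \<noteq> 0" for x y
    using t1(1) t2(1) that by (cases "t1 x y = 0") auto
  with t1 t2 show ?thesis
    unfolding transportable_def
    by (intro exI[of _ "\<lambda>x y. t1 x y + t2 x y"]) (auto simp: sum.distrib)
qed

lemma transportable_refl:
  assumes "\<And>x. x \<in> pverts G \<Longrightarrow> 0 \<le> w x"
  shows "transportable G w w"
  unfolding transportable_def
  by (rule exI[of _ "\<lambda>x y. if x = y then w x else 0"])
    (use assms in \<open>auto simp: closed_nbhd_def\<close>)

text \<open>
  If every source vertex reaches every target vertex, each source can be spread over the targets
  in proportion to their demands.
\<close>

lemma transportable_product:
  assumes nonneg: "\<And>x. x \<in> pverts G \<Longrightarrow> 0 \<le> w x" "\<And>x. x \<in> pverts G \<Longrightarrow> 0 \<le> w' x"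
    and total: "total_weight G w = total_weight G w'"
    and reach: "\<And>x y. x \<in> pverts G \<Longrightarrow> y \<in> pverts G \<Longrightarrow> w x \<noteq> 0 \<Longrightarrow> w' y \<noteq> 0 \<Longrightarrow>
      y \<in> closed_nbhd G x"
  shows "transportable G w w'"
proof -
  define T where "T = total_weight G w"
  have T: "(\<Sum>x\<in>pverts G. w x) = T" "(\<Sum>x\<in>pverts G. w' x) = T"
    using total by (simp_all add: T_def total_weight_def)
  have "T \<ge> 0" using T(1) nonneg(1) by (metis sum_nonneg)
  \<comment> \<open>For \<open>T = 0\<close> both functions vanish, and so does the plan, because of the division by 0.\<close>
  have zero: "w x = 0" "w' x = 0" if "T = 0" "x \<in> pverts G" for x
    using that T nonneg sum_nonneg_eq_0_iff[of "pverts G" w]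
      sum_nonneg_eq_0_iff[of "pverts G" w'] by auto
  have out: "(\<Sum>y\<in>pverts G. w x * w' y / T) = w x" if "x \<in> pverts G" for x
    using zero[OF _ that] T(2)
    by (cases "T = 0") (simp_all flip: sum_distrib_left sum_divide_distrib)
  have into: "(\<Sum>x\<in>pverts G. w x * w' y / T) = w' y" if "y \<in> pverts G" for y
    using zero[OF _ that] T(1)
    by (cases "T = 0") (simp_all flip: sum_distrib_right sum_divide_distrib)
  show ?thesis
    unfolding transportable_def
    by (rule exI[of _ "\<lambda>x y. w x * w' y / T"])
      (use out into nonneg reach \<open>T \<ge> 0\<close> in \<open>auto\<close>)
qed

text \<open>
  The weight \<open>s\<close> that leaves \<open>u\<close> is spread over the neighbours in \<open>A\<close> in proportion to their demands
  \<open>w\<close>. It covers a part \<open>p\<close> of the demands; because of \<open>p \<le> w\<close>, the demands that remain are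
  nonnegative and can be met from elsewhere. Read backwards, with \<open>w\<close> as a stock, this also serves
  weight that has to arrive at \<open>u\<close>.
\<close>

lemma evacuate_vertex:
  assumes w: "\<And>x. x \<in> A \<Longrightarrow> 0 \<le> w x" and A: "A \<subseteq> pverts G"
    and s: "\<And>x. x \<in> pverts G \<Longrightarrow> x \<noteq> u \<Longrightarrow> s x = 0" "0 \<le> s u"
    and u: "u \<in> pverts G"
    and room: "s u \<le> (\<Sum>x\<in>nbhd G u \<inter> A. w x)"
  obtains p where "transportable G s p" and "total_weight G p = total_weight G s"
    and "\<And>x. x \<in> A \<Longrightarrow> 0 \<le> p x \<and> p x \<le> w x" and "\<And>x. x \<notin> A \<Longrightarrow> p x = 0"
proof -
  define W where "W = (\<Sum>x\<in>nbhd G u \<inter> A. w x)"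
  define p where "p = (\<lambda>x. if x \<in> nbhd G u \<inter> A then s u * w x / W else 0)"
  have W: "0 \<le> s u" "s u \<le> W" using s(2) room by (simp_all add: W_def)
  have sub: "nbhd G u \<inter> A \<subseteq> pverts G" using A by blast
  have "total_weight G p = (\<Sum>x\<in>nbhd G u \<inter> A. s u * w x / W)"
    unfolding total_weight_def p_def
    using sum.inter_restrict[of "pverts G" "\<lambda>x. s u * w x / W" "nbhd G u \<inter> A"] sub
    by (simp add: Int_absorb1)
  also have "\<dots> = s u"
    using W unfolding W_def[symmetric]
    by (simp flip: sum_distrib_left sum_divide_distrib add: W_def[symmetric])
  also have "\<dots> = total_weight G s"
    using sum.remove[of "pverts G" u s] u s(1) by (simp add: total_weight_def)
  finally have total: "total_weight G p = total_weight G s" .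
  have p: "0 \<le> p x" "p x \<le> w x" if "x \<in> A" for x
  proof -
    show "0 \<le> p x" using w[OF that] W by (simp add: p_def)
    have "0 \<le> W" using W by linarith
    then have "s u / W \<le> 1" using W by (simp add: divide_le_eq_1 less_le)
    then have "s u / W * w x \<le> 1 * w x" by (intro mult_right_mono w[OF that])
    then show "p x \<le> w x" using w[OF that] by (simp add: p_def)
  qed
  have off: "p x = 0" if "x \<notin> A" for x using that by (simp add: p_def)
  have "transportable G s p"
  proof (rule transportable_product)
    show "0 \<le> s x" if "x \<in> pverts G" for x using s that by (cases "x = u") auto
    show "0 \<le> p x" if "x \<in> pverts G" for x using p(1) off by (cases "x \<in> A") auto
    show "y \<in> closed_nbhd G x"
      if "x \<in> pverts G" "y \<in> pverts G" "s x \<noteq> 0" "p y \<noteq> 0" for x y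
    proof -
      have "x = u" using s(1) that by blast
      moreover have "y \<in> nbhd G u" using that(4) by (auto simp: p_def split: if_splits)
      ultimately show ?thesis by (simp add: closed_nbhd_def)
    qed
  qed (simp add: total)
  then show thesis using that total p off by blast
qed

section \<open>Eternal domination by pairwise transportable guards\<close>

lemma legal_move_cong:
  assumes "\<And>x. x \<in> pverts G \<Longrightarrow> w x = w' x"
  shows "legal_move G w m = legal_move G w' m"
  using assms by (simp add: legal_move_def)

lemma frac_dominating_cong:
  assumes "\<And>x. x \<in> pverts G \<Longrightarrow> w x = w' x"
  shows "frac_dominating G w = frac_dominating G w'"
proof -
  have "(\<Sum>x\<in>closed_nbhd G v. w x) = (\<Sum>x\<in>closed_nbhd G v. w' x)" if "v \<in> pverts G" for v
    by (rule sum.cong) (use assms that nbhd_subset in \<open>auto simp: closed_nbhd_def\<close>)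
  then show ?thesis using assms by (simp add: frac_dominating_def)
qed

lemma total_weight_apply_move: "total_weight G (apply_move G w m) = total_weight G w"
proof -
  have "(\<Sum>x\<in>pverts G. \<Sum>y\<in>nbhd G x. m y x)
      = (\<Sum>x\<in>pverts G. \<Sum>y | y \<in> pverts G \<and> (x, y) \<in> parcs G. m y x)"
    by (simp add: nbhd_def)
  also have "\<dots> = (\<Sum>y\<in>pverts G. \<Sum>x | x \<in> pverts G \<and> (x, y) \<in> parcs G. m y x)"
    by (rule sum.swap_restrict) simp_all
  also have "\<dots> = (\<Sum>y\<in>pverts G. \<Sum>x\<in>nbhd G y. m y x)"
    by (intro sum.cong) (auto simp: nbhd_def intro: arcs_symmetric)
  finally show ?thesis
    by (simp add: total_weight_def apply_move_def sum.distrib sum_subtractf)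
qed

lemma eternally_dominable_lower_bound:
  assumes "eternally_dominable G S" and v: "v \<in> pverts G"
  shows "least_weight_at G v \<le> S"
proof -
  obtain w1 \<sigma> where S: "total_weight G w1 \<le> S"
    and win: "\<And>a i. (\<forall>i. a i \<in> pverts G) \<Longrightarrow>
      frac_dominating G (weight_at G w1 \<sigma> a (Suc i)) \<and> weight_at G w1 \<sigma> a (Suc i) (a i) \<ge> 1"
    using assms(1) unfolding eternally_dominable_def by blast
  define w where "w = weight_at G w1 \<sigma> (\<lambda>_. v) (Suc 0)"
  have "frac_dominating G w" "w v \<ge> 1" using win[of "\<lambda>_. v" 0] v by (simp_all add: w_def)
  then have "least_weight_at G v \<le> total_weight G w"
    by (rule least_weight_at_attained(2)[OF pair_graph_axioms v])
  also have "total_weight G w = total_weight G w1"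
    by (simp add: w_def total_weight_apply_move)
  finally show ?thesis using S by simp
qed

text \<open>
  The strategy is memoryless: after an attack on \<open>u\<close> the weights are those of \<open>c u\<close>, and the attack
  on \<open>v\<close> is answered with a fixed move from \<open>c u\<close> to \<open>c v\<close>.
\<close>

lemma eternally_dominable_by_guards:
  assumes "pverts G \<noteq> {}"
    and dom: "\<And>v. v \<in> pverts G \<Longrightarrow> frac_dominating G (c v)"
    and guard: "\<And>v. v \<in> pverts G \<Longrightarrow> c v v \<ge> 1"
    and total: "\<And>v. v \<in> pverts G \<Longrightarrow> total_weight G (c v) \<le> S"
    and transport: "\<And>u v. u \<in> pverts G \<Longrightarrow> v \<in> pverts G \<Longrightarrow> transportable G (c u) (c v)"
  shows "eternally_dominable G S"
proof -
  obtain v0 where v0: "v0 \<in> pverts G" using assms(1) by blast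
  have "\<forall>u v. \<exists>m. u \<in> pverts G \<longrightarrow> v \<in> pverts G \<longrightarrow>
      legal_move G (c u) m \<and> (\<forall>x\<in>pverts G. apply_move G (c u) m x = c v x)"
    by (metis transport transportable_imp_move)
  then obtain M where M: "\<And>u v. u \<in> pverts G \<Longrightarrow> v \<in> pverts G \<Longrightarrow>
      legal_move G (c u) (M u v) \<and> (\<forall>x\<in>pverts G. apply_move G (c u) (M u v) x = c v x)"
    by metis
  define \<sigma> where "\<sigma> = (\<lambda>l. M (last (v0 # butlast l)) (last l))"
  show ?thesis
    unfolding eternally_dominable_def
  proof (intro exI conjI allI impI)
    show "frac_dominating G (c v0)" "total_weight G (c v0) \<le> S"
      using dom total v0 by auto
    fix a :: "nat \<Rightarrow> 'a" and i
    assume a: "\<forall>i. a i \<in> pverts G"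
    define prev where "prev i = last (v0 # map a [0..<i])" for i
    have prev_Suc: "prev (Suc i) = a i" for i by (simp add: prev_def)
    have prev: "prev i \<in> pverts G" for i
      using a v0 by (cases i) (simp_all add: prev_def)
    have \<sigma>: "\<sigma> (map a [0..<Suc i]) = M (prev i) (a i)" for i
      by (simp add: \<sigma>_def prev_def)
    have state: "\<forall>x\<in>pverts G. weight_at G (c v0) \<sigma> a i x = c (prev i) x" for i
    proof (induction i)
      case 0
      show ?case by (simp add: prev_def)
    next
      case (Suc i)
      have "apply_move G (weight_at G (c v0) \<sigma> a i) (M (prev i) (a i)) x
          = apply_move G (c (prev i)) (M (prev i) (a i)) x" if "x \<in> pverts G" for x
        using Suc that by (simp add: apply_move_def)
      then show ?case
        using M[OF prev, of "a i" i] a unfolding weight_at.simps \<sigma> prev_Suc by simp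
    qed
    show "legal_move G (weight_at G (c v0) \<sigma> a i) (\<sigma> (map a [0..<Suc i]))"
      unfolding \<sigma> using M[OF prev, of "a i" i] a state legal_move_cong by blast
    show "frac_dominating G (weight_at G (c v0) \<sigma> a (Suc i))"
      using frac_dominating_cong[of "weight_at G (c v0) \<sigma> a (Suc i)" "c (a i)"] state[of "Suc i"]
        dom a unfolding prev_Suc by blast
    show "weight_at G (c v0) \<sigma> a (Suc i) (a i) \<ge> 1"
      using state[of "Suc i"] guard a unfolding prev_Suc by metis
  qed
qed

section \<open>Guards in split graphs\<close>

context
  fixes K I
  assumes KI: "K \<union> I = pverts G" "K \<inter> I = {}"
    and K: "clique G K" and I: "independent_set G I"
begin

lemma finite_parts: "finite K" "finite I"
  using KI(1) pair_finite_verts by (metis finite_Un)+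

lemma sum_parts: "(\<Sum>x\<in>pverts G. w x) = (\<Sum>x\<in>K. w x) + (\<Sum>x\<in>I. w x)"
  for w :: "'a \<Rightarrow> real"
  unfolding KI(1)[symmetric] by (rule sum.union_disjoint) (use finite_parts KI(2) in auto)

lemma nbhd_independent: "x \<in> I \<Longrightarrow> nbhd G x \<subseteq> K"
  using I KI by (auto simp: nbhd_def independent_set_def)

lemma sum_closed_nbhd_clique:
  fixes w :: "'a \<Rightarrow> real"
  assumes "x \<in> K"
  shows "(\<Sum>y\<in>closed_nbhd G x. w y) = (\<Sum>y\<in>K. w y) + (\<Sum>y\<in>nbhd G x \<inter> I. w y)"
proof -
  have "closed_nbhd G x = K \<union> (nbhd G x \<inter> I)"
    using assms K KI(1) by (auto simp: closed_nbhd_def nbhd_def clique_def)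
  then show ?thesis
    using sum.union_disjoint[of K "nbhd G x \<inter> I" w] finite_parts KI(2) by auto
qed

text \<open>
  In \<open>I\<close> at most \<open>u\<close> loses weight and at most \<open>v\<close> gains weight. As the weights there are at most 1,
  domination ensures that the neighbours in \<open>K\<close> can absorb the loss and supply the gain. The plan has four parts:
  what stays in \<open>I\<close>, what leaves \<open>u\<close>, what arrives at \<open>v\<close>, and a rearrangement inside \<open>K\<close>.
\<close>

lemma transportable_split:
  assumes dom: "frac_dominating G w" "frac_dominating G w'"
    and total: "total_weight G w = total_weight G w'"
    and uv: "u \<in> pverts G" "v \<in> pverts G"
    and le1: "\<And>x. x \<in> I \<Longrightarrow> w x \<le> 1" "\<And>x. x \<in> I \<Longrightarrow> w' x \<le> 1"
    and only_u: "\<And>x. x \<in> I \<Longrightarrow> x \<noteq> u \<Longrightarrow> w x \<le> w' x"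
    and only_v: "\<And>x. x \<in> I \<Longrightarrow> x \<noteq> v \<Longrightarrow> w' x \<le> w x"
  shows "transportable G w w'"
proof -
  have nonneg: "0 \<le> w x" "0 \<le> w' x" if "x \<in> pverts G" for x
    using dom that by (simp_all add: frac_dominating_def)
  have KV: "K \<subseteq> pverts G" using KI(1) by blast
  define stay where "stay x = (if x \<in> I then min (w x) (w' x) else 0)" for x
  define leave where "leave x = (if x \<in> I then max 0 (w x - w' x) else 0)" for x
  define arrive where "arrive x = (if x \<in> I then max 0 (w' x - w x) else 0)" for x
  \<comment> \<open>A vertex of \<open>I\<close> has weight at most 1 but sees weight at least 1 in the other function, and
    all of its neighbours lie in \<open>K\<close>.\<close>
  have room: "max 0 (f x - g x) \<le> (\<Sum>y\<in>nbhd G x \<inter> K. g y)"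
    if g: "frac_dominating G g" and "f x \<le> 1" and x: "x \<in> I" for f g :: "'a \<Rightarrow> real" and x
  proof -
    have "x \<in> pverts G" using x KI(1) by blast
    then have "1 \<le> g x + (\<Sum>y\<in>nbhd G x. g y)"
      using g by (simp add: frac_dominating_def flip: sum_closed_nbhd)
    moreover have "0 \<le> (\<Sum>y\<in>nbhd G x. g y)"
      using g nbhd_subset[of x] by (intro sum_nonneg) (auto simp: frac_dominating_def)
    moreover have "nbhd G x \<inter> K = nbhd G x" using nbhd_independent[OF x] by blast
    ultimately show ?thesis using \<open>f x \<le> 1\<close> by simp
  qed
  have roomK: "0 \<le> (\<Sum>y\<in>nbhd G x \<inter> K. g y)" if "frac_dominating G g" for g x
    using that nbhd_subset[of x] by (intro sum_nonneg) (auto simp: frac_dominating_def)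
  obtain p where p: "transportable G leave p" "total_weight G p = total_weight G leave"
    "\<And>x. x \<in> K \<Longrightarrow> 0 \<le> p x \<and> p x \<le> w' x" "\<And>x. x \<notin> K \<Longrightarrow> p x = 0"
  proof (rule evacuate_vertex[of K w' u leave])
    show "leave x = 0" if "x \<in> pverts G" "x \<noteq> u" for x
      using only_u[of x] that by (simp add: leave_def)
    show "leave u \<le> (\<Sum>x\<in>nbhd G u \<inter> K. w' x)"
      using room[of w' w u] roomK[of w' u] dom le1 by (simp add: leave_def)
  qed (use nonneg KV uv in \<open>auto simp: leave_def\<close>)
  obtain q where q: "transportable G arrive q" "total_weight G q = total_weight G arrive"
    "\<And>x. x \<in> K \<Longrightarrow> 0 \<le> q x \<and> q x \<le> w x" "\<And>x. x \<notin> K \<Longrightarrow> q x = 0"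
  proof (rule evacuate_vertex[of K w v arrive])
    show "arrive x = 0" if "x \<in> pverts G" "x \<noteq> v" for x
      using only_v[of x] that by (simp add: arrive_def)
    show "arrive v \<le> (\<Sum>x\<in>nbhd G v \<inter> K. w x)"
      using room[of w w' v] roomK[of w v] dom le1 by (simp add: arrive_def)
  qed (use nonneg KV uv in \<open>auto simp: arrive_def\<close>)
  define rest where "rest x = (if x \<in> K then w x - q x else 0)" for x
  define rest' where "rest' x = (if x \<in> K then w' x - p x else 0)" for x
  have w: "w x = stay x + leave x + q x + rest x" if "x \<in> pverts G" for x
    using that KI q(4)[of x] by (auto simp: stay_def leave_def rest_def)
  have w': "w' x = stay x + p x + arrive x + rest' x" if "x \<in> pverts G" for x
    using that KI p(4)[of x] by (auto simp: stay_def arrive_def rest'_def)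
  have "total_weight G rest = total_weight G rest'"
  proof -
    have "total_weight G w
        = total_weight G stay + total_weight G leave + total_weight G q + total_weight G rest"
      unfolding total_weight_def by (simp add: w flip: sum.distrib)
    moreover have "total_weight G w'
        = total_weight G stay + total_weight G p + total_weight G arrive + total_weight G rest'"
      unfolding total_weight_def by (simp add: w' flip: sum.distrib)
    ultimately show ?thesis using total p(2) q(2) by simp
  qed
  then have "transportable G rest rest'"
  proof (rule transportable_product[rotated 2])
    show "y \<in> closed_nbhd G x"
      if "x \<in> pverts G" "y \<in> pverts G" "rest x \<noteq> 0" "rest' y \<noteq> 0" for x y
      using that K by (auto simp: rest_def rest'_def closed_nbhd_def nbhd_def clique_def
          split: if_splits)
  qed (use p(3) q(3) in \<open>auto simp: rest_def rest'_def\<close>)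
  moreover have "transportable G stay stay"
    by (rule transportable_refl) (use nonneg in \<open>auto simp: stay_def\<close>)
  ultimately have "transportable G (\<lambda>x. stay x + leave x + q x + rest x)
      (\<lambda>x. stay x + p x + arrive x + rest' x)"
    using p(1) transportable_converse[OF q(1)] by (intro transportable_add)
  then show ?thesis
    by (rule transportable_cong) (simp_all add: w w')
qed

text \<open>
  Start from a cheapest dominating function with weight at least 1 at \<open>v\<close>. On \<open>I\<close> it is at least the
  required indicator function. The excess at \<open>x\<close> goes to a neighbour \<open>g x\<close>, which dominates everything
  that \<open>x\<close> dominates. The excess at isolated vertices and the unused part of the budget go to a
  vertex \<open>k\<close> of \<open>K\<close>; they equalise the totals of the guards, as no move changes the total.
\<close>

lemma guard_exists:
  assumes v: "v \<in> pverts G" and k: "k \<in> K" and T: "least_weight_at G v \<le> T"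
  obtains w where "frac_dominating G w" and "w v \<ge> 1" and "total_weight G w = T"
    and "\<And>x. x \<in> I \<Longrightarrow> w x = (if nbhd G x = {} \<or> x = v then 1 else 0)"
proof -
  obtain w0 where w0: "frac_dominating G w0" "w0 v \<ge> 1" "total_weight G w0 = least_weight_at G v"
    using least_weight_at_attained(1)[OF pair_graph_axioms v] by blast
  have nonneg: "0 \<le> w0 x" if "x \<in> pverts G" for x
    using w0(1) that by (simp add: frac_dominating_def)
  have dom: "1 \<le> (\<Sum>y\<in>closed_nbhd G x. w0 y)" if "x \<in> pverts G" for x
    using w0(1) that by (simp add: frac_dominating_def)
  define ind :: "'a \<Rightarrow> real" where "ind x = (if nbhd G x = {} \<or> x = v then 1 else 0)" for x
  define e where "e x = w0 x - ind x" for x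
  define g where "g x = (if nbhd G x = {} then k else SOME y. y \<in> nbhd G x)" for x
  define gain where "gain y = (\<Sum>x\<in>{x\<in>I. g x = y}. e x)
    + (if y = k then T - total_weight G w0 else 0)" for y
  define w where "w x = (if x \<in> K then w0 x + gain x else ind x)" for x
  have g_nbhd: "g x \<in> nbhd G x" if "nbhd G x \<noteq> {}" for x
    using that by (auto simp: g_def some_in_eq)
  have g_K: "g x \<in> K" if "x \<in> I" for x
    using g_nbhd nbhd_independent[OF that] k by (cases "nbhd G x = {}") (auto simp: g_def)
  have e: "0 \<le> e x" if "x \<in> I" for x
  proof -
    have x: "x \<in> pverts G" using that KI(1) by blast
    show ?thesis
      using dom[OF x] nonneg[OF x] w0(2)
      by (auto simp: e_def ind_def sum_closed_nbhd)
  qed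
  have gain_ge: "(\<Sum>x\<in>{x\<in>I. g x = y}. e x) \<le> gain y" for y
    using T w0(3) by (simp add: gain_def)
  have gain: "0 \<le> gain y" for y
    by (rule order_trans[OF sum_nonneg gain_ge]) (use e in auto)
  have sum_gain: "(\<Sum>y\<in>K. gain y) = (\<Sum>x\<in>I. e x) + (T - total_weight G w0)"
  proof -
    have "(\<Sum>y\<in>K. \<Sum>x\<in>{x\<in>I. g x = y}. e x) = (\<Sum>x\<in>I. e x)"
      by (rule sum.group) (use finite_parts g_K in auto)
    then show ?thesis using finite_parts(1) k by (simp add: gain_def sum.distrib)
  qed
  have w_I: "w x = ind x" if "x \<in> I" for x using that KI(2) by (auto simp: w_def)
  have sum_K: "(\<Sum>x\<in>K. w x) = (\<Sum>x\<in>K. w0 x) + (\<Sum>x\<in>I. e x) + (T - total_weight G w0)"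
    by (simp add: w_def sum.distrib sum_gain)
  have total: "total_weight G w = T"
    unfolding total_weight_def sum_parts sum_K
    by (simp add: w_I e_def sum_subtractf sum_parts total_weight_def)
  have "w v \<ge> 1"
    using v KI w0(2) gain[of v] by (cases "v \<in> K") (auto simp: w_def ind_def)
  moreover have "frac_dominating G w"
    unfolding frac_dominating_def
  proof (intro conjI ballI)
    show w_nonneg: "0 \<le> w x" if "x \<in> pverts G" for x
      using nonneg[OF that] gain[of x] by (simp add: w_def ind_def)
    fix x assume x: "x \<in> pverts G"
    have "ind x = 1 \<or> ind x = 0 \<and> nbhd G x \<noteq> {}" by (simp add: ind_def)
    then consider "x \<in> K" | "x \<in> I" "ind x = 1" | "x \<in> I" "ind x = 0" "nbhd G x \<noteq> {}"
      using x KI(1) by blast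
    then show "1 \<le> (\<Sum>y\<in>closed_nbhd G x. w y)"
    proof cases
      case 1
      have "(\<Sum>y\<in>nbhd G x \<inter> I. e y) \<le> (\<Sum>y\<in>I. e y)"
        by (rule sum_mono2) (use finite_parts e in auto)
      moreover have "(\<Sum>y\<in>nbhd G x \<inter> I. w y) = (\<Sum>y\<in>nbhd G x \<inter> I. w0 y) - (\<Sum>y\<in>nbhd G x \<inter> I. e y)"
        by (simp add: w_I e_def sum_subtractf)
      ultimately show ?thesis
        using dom[OF x] T w0(3) unfolding sum_closed_nbhd_clique[OF 1] sum_K by linarith
    next
      case 2
      have "0 \<le> (\<Sum>y\<in>nbhd G x. w y)"
        using w_nonneg nbhd_subset[of x] by (intro sum_nonneg) auto
      then show ?thesis using 2 by (simp add: sum_closed_nbhd w_I)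
    next
      case 3
      have "e x \<le> (\<Sum>z\<in>{z\<in>I. g z = g x}. e z)"
        by (rule member_le_sum) (use 3 finite_parts e in auto)
      also have "\<dots> \<le> gain (g x)" by (rule gain_ge)
      also have "\<dots> \<le> (\<Sum>y\<in>nbhd G x. gain y)"
        by (rule member_le_sum) (use g_nbhd[OF 3(3)] gain finite_nbhd in auto)
      finally have "e x \<le> (\<Sum>y\<in>nbhd G x. gain y)" .
      moreover have "(\<Sum>y\<in>nbhd G x. w y) = (\<Sum>y\<in>nbhd G x. w0 y + gain y)"
        by (rule sum.cong) (use nbhd_independent[OF 3(1)] in \<open>auto simp: w_def\<close>)
      ultimately show ?thesis
        using dom[OF x] 3 by (simp add: sum_closed_nbhd w_I sum.distrib e_def)
    qed
  qed
  ultimately show thesis using that total w_I by (simp add: ind_def)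
qed

lemma eternally_dominable_split:
  assumes "k \<in> K" and T: "\<And>v. v \<in> pverts G \<Longrightarrow> least_weight_at G v \<le> T"
  shows "eternally_dominable G T"
proof -
  have "\<forall>v. \<exists>w. v \<in> pverts G \<longrightarrow> frac_dominating G w \<and> w v \<ge> 1 \<and> total_weight G w = T \<and>
      (\<forall>x\<in>I. w x = (if nbhd G x = {} \<or> x = v then 1 else 0))"
    by (metis guard_exists[OF _ \<open>k \<in> K\<close> T])
  from choice[OF this] obtain c where c: "\<And>v. v \<in> pverts G \<Longrightarrow>
      frac_dominating G (c v) \<and> c v v \<ge> 1 \<and> total_weight G (c v) = T \<and>
      (\<forall>x\<in>I. c v x = (if nbhd G x = {} \<or> x = v then 1 else 0))"
    by blast
  show ?thesis
  proof (rule eternally_dominable_by_guards)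
    show "transportable G (c u) (c v)" if "u \<in> pverts G" "v \<in> pverts G" for u v
      by (rule transportable_split[of _ _ u v]) (use that c in auto)
  qed (use c \<open>k \<in> K\<close> KI(1) in auto)
qed

end

end

text \<open>A single vertex is a clique, so the clique of the partition can be chosen nonempty.\<close>

lemma split_graph_nonempty_clique:
  assumes "split_graph G" and "pverts G \<noteq> {}"
  obtains K I where "K \<union> I = pverts G" "K \<inter> I = {}" "clique G K" "independent_set G I" "K \<noteq> {}"
proof -
  obtain K I where KI: "K \<union> I = pverts G" "K \<inter> I = {}" "clique G K" "independent_set G I"
    using assms(1) unfolding split_graph_def by blast
  show thesis
  proof (cases "K = {}")
    case True
    obtain x where "x \<in> pverts G" using assms(2) by blast
    with True KI show thesis
      by (intro that[of "{x}" "I - {x}"]) (auto simp: clique_def independent_set_def)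
  qed (use KI that in blast)
qed

theorem proposition4p6:
  fixes G :: "'a pair_pre_digraph"
  assumes "split_graph G" and "pverts G \<noteq> {}"
  shows "frac_eternal_domination_number G = max_least_weight G"
proof -
  interpret pair_graph G using assms(1) by (simp add: split_graph_def)
  obtain K I where KI: "K \<union> I = pverts G" "K \<inter> I = {}" "clique G K" "independent_set G I" "K \<noteq> {}"
    using split_graph_nonempty_clique[OF assms] .
  have "least_weight_at G v \<le> max_least_weight G" if "v \<in> pverts G" for v
    unfolding max_least_weight_def using that by (intro Max_ge) auto
  then have upper: "eternally_dominable G (max_least_weight G)"
    using eternally_dominable_split[OF KI(1-4)] KI(5) by blast
  have lower: "max_least_weight G \<le> S" if "eternally_dominable G S" for S
    unfolding max_least_weight_def
    using assms(2) eternally_dominable_lower_bound[OF that] by (intro Max.boundedI) auto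
  show ?thesis
    unfolding frac_eternal_domination_number_def
    using upper lower by (intro cInf_eq_minimum) auto
qed

end
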